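(* Let $X_2=\mathbb{N}\times\{0,1\}$ with the metric $$d_2\bigl((n,i),(n',j)\bigr)=\begin{cases}0,&(n,i)=(n',j),\\ 1,&(n,i)\ne(n',j)\text{ and }n=n',\\ 2,&n\ne n'.\end{cases}$$ Then the space $(X_2,d_2)$ is plastic.
   Context: A map $f$ between metric spaces is nonexpansive if $d(f(x),f(y))\le d(x,y)$ for all $x,y$. A metric space is plastic if every bijective nonexpansive self-map is an isometry. *)

theory Defs
  imports "HOL-Analysis.Analysis"
begin

definition nonexpansive_map ::
  "'a set \<Rightarrow> ('a \<Rightarrow> 'a \<Rightarrow> real) \<Rightarrow> 'b set \<Rightarrow> ('b \<Rightarrow> 'b \<Rightarrow> real) \<Rightarrow> ('a \<Rightarrow> 'b) \<Rightarrow> bool"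
  where "nonexpansive_map M d M' d' f \<longleftrightarrow>
    f \<in> M \<rightarrow> M' \<and> (\<forall>x\<in>M. \<forall>y\<in>M. d' (f x) (f y) \<le> d x y)"

definition isometry_map ::
  "'a set \<Rightarrow> ('a \<Rightarrow> 'a \<Rightarrow> real) \<Rightarrow> 'b set \<Rightarrow> ('b \<Rightarrow> 'b \<Rightarrow> real) \<Rightarrow> ('a \<Rightarrow> 'b) \<Rightarrow> bool"
  where "isometry_map M d M' d' f \<longleftrightarrow>
    bij_betw f M M' \<and> (\<forall>x\<in>M. \<forall>y\<in>M. d' (f x) (f y) = d x y)"

definition plastic :: "'a set \<Rightarrow> ('a \<Rightarrow> 'a \<Rightarrow> real) \<Rightarrow> bool"
  where "plastic M d \<longleftrightarrow> Metric_space M d \<and>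
    (\<forall>f. bij_betw f M M \<and> nonexpansive_map M d M d f \<longrightarrow> isometry_map M d M d f)"

definition X2 :: "(nat \<times> nat) set"
  where "X2 = UNIV \<times> {0, 1}"

definition d2 :: "nat \<times> nat \<Rightarrow> nat \<times> nat \<Rightarrow> real"
  where "d2 x y = (if x = y then 0 else if fst x = fst y then 1 else 2)"

end

theory Submission
  imports Defs
begin

text \<open>
  Each point of \<open>X2\<close> has exactly one other point at distance \<open>1\<close>, its twin over the same natural
  number, and every remaining pair of distinct points is at distance \<open>2\<close>. An injective nonexpansive
  map cannot collapse twins, so it sends twins to twins. Conversely, if \<open>f x\<close> and \<open>f y\<close> are twins,
  then the twin of \<open>x\<close> also goes to the twin of \<open>f x\<close>, which is \<open>f y\<close>, and injectivity makes \<open>y\<close>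
  the twin of \<open>x\<close>. Hence distance \<open>1\<close> is both preserved and reflected, and distance \<open>2\<close> with it.
\<close>

definition twin :: "nat \<times> nat \<Rightarrow> nat \<times> nat"
  where "twin x = (fst x, 1 - snd x)"

lemma twin_in_X2: "x \<in> X2 \<Longrightarrow> twin x \<in> X2"
  by (auto simp: X2_def twin_def)

lemma d2_eq_1_iff_twin:
  assumes "x \<in> X2" "y \<in> X2"
  shows "d2 x y = 1 \<longleftrightarrow> y = twin x"
  using assms by (auto simp: X2_def d2_def twin_def)

lemma Metric_space_X2: "Metric_space X2 d2"
  by unfold_locales (auto simp: d2_def)

text \<open>
  Commuting with \<open>twin\<close> is the whole content: it turns the one-sided bound on distances into an
  equivalence for distance \<open>1\<close>, and injectivity gives the equivalence for distance \<open>0\<close>.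
\<close>

lemma inj_nonexpansive_preserves_d2:
  assumes inj: "inj_on f X2" and ne: "nonexpansive_map X2 d2 X2 d2 f"
    and x: "x \<in> X2" and y: "y \<in> X2"
  shows "d2 (f x) (f y) = d2 x y"
proof -
  have fX: "f z \<in> X2" if "z \<in> X2" for z
    using ne that by (auto simp: nonexpansive_map_def)
  have twin_image: "f (twin z) = twin (f z)" if z: "z \<in> X2" for z
  proof -
    have d1: "d2 z (twin z) = 1"
      using d2_eq_1_iff_twin[OF z twin_in_X2[OF z]] by simp
    then have "f z \<noteq> f (twin z)"
      using inj_onD[OF inj _ z twin_in_X2[OF z]] by (auto simp: d2_def)
    moreover have "d2 (f z) (f (twin z)) \<le> 1"
      using ne z twin_in_X2[OF z] d1 by (fastforce simp: nonexpansive_map_def)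
    ultimately have "d2 (f z) (f (twin z)) = 1"
      by (auto simp: d2_def split: if_splits)
    then show ?thesis
      using d2_eq_1_iff_twin[OF fX[OF z] fX[OF twin_in_X2[OF z]]] by simp
  qed
  have "f y = f x \<longleftrightarrow> y = x"
    using inj_on_eq_iff[OF inj y x] .
  moreover have "f y = twin (f x) \<longleftrightarrow> y = twin x"
    using inj_on_eq_iff[OF inj y twin_in_X2[OF x]] twin_image[OF x] by simp
  then have "d2 (f x) (f y) = 1 \<longleftrightarrow> d2 x y = 1"
    using d2_eq_1_iff_twin[OF x y] d2_eq_1_iff_twin[OF fX[OF x] fX[OF y]] by simp
  ultimately show ?thesis
    by (auto simp: d2_def split: if_splits)
qed

theorem proposition2p7:
  shows "plastic X2 d2"
  unfolding plastic_def isometry_map_def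
  using Metric_space_X2 inj_nonexpansive_preserves_d2 bij_betw_imp_inj_on by blast

end
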